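(* Let $w\in S_n$ contain the pattern $132$, and let $p=\max\{t : \exists\, i<t<j,\ w_i<w_j<w_t\}$ and $q=\max\{j : j>p,\ w_j<w_p,\ \exists\, i<p,\ w_i<w_j\}$. Then $$F_w(x)=\sum_{w'\in \Phi(wt_{p,q},p)}F_{w'}(x).$$ Moreover, the set $I(wt_{p,q},p)$ is nonempty, and hence every permutation in $\Phi(wt_{p,q},p)$ is a permutation in $S_n$.
   Context: Permutations are in one-line notation $u=u_1\cdots u_n$; $\ell(u)$ is the number of inversions. For positions $a<b$, $ut_{a,b}$ swaps $u_a$ and $u_b$. For $1\le k\le n$ let $I(u,k)=\{i<k : \ell(ut_{i,k})=\ell(u)+1\}$. Let $1\times u=1(u_1+1)(u_2+1)\cdots(u_n+1)\in S_{n+1}$. Define recursively $\Phi(u,k)=\{ut_{i,k}: i\in I(u,k)\}$ if $I(u,k)\ne\emptyset$, and $\Phi(u,k)=\Phi(1\times u,k+1)$ otherwise. Let $s_i$ be the simple transposition of $i,i+1$, with $ws_i$ obtained from $w$ by swapping $w_i,w_{i+1}$; $(a_1,\ldots,a_\ell)$ is a reduced word of $w$ if $w=s_{a_1}\cdots s_{a_\ell}$ with $\ell=\ell(w)$. The Stanley symmetric function is $$F_w(x)=\sum_{(a_1,\ldots,a_\ell)}\ \sum_{\substack{1\le b_1\le\cdots\le b_\ell\\ a_i<a_{i+1}\Rightarrow b_i<b_{i+1}}} x_{b_1}\cdots x_{b_\ell},$$ the outer sum over all reduced words of $w$. *)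

theory Defs
  imports
    "HOL-Combinatorics.Combinatorics"
    "HOL-Library.Multiset"
    "HOL-Library.Function_Algebras"
begin

text \<open>
  A permutation \<open>u\<close> in $S_n$ is a function on \<open>nat\<close> with \<open>u permutes {1..n}\<close>; its one-line
  notation is \<open>u 1, ..., u n\<close>. It fixes \<open>0\<close> and every \<open>i > n\<close>, so length, \<open>I_set\<close>,
  \<open>Phi\<close> and \<open>stanley\<close> need no parameter \<open>n\<close>.
\<close>

definition inv_count :: "(nat \<Rightarrow> nat) \<Rightarrow> nat" where
  "inv_count u = card {(i, j). 1 \<le> i \<and> i < j \<and> u j < u i}"

definition swap_pos :: "(nat \<Rightarrow> nat) \<Rightarrow> nat \<Rightarrow> nat \<Rightarrow> (nat \<Rightarrow> nat)" where
  "swap_pos u a b = u \<circ> transpose a b"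

definition I_set :: "(nat \<Rightarrow> nat) \<Rightarrow> nat \<Rightarrow> nat set" where
  "I_set u k = {i. 1 \<le> i \<and> i < k \<and> inv_count (swap_pos u i k) = inv_count u + 1}"

definition one_times :: "(nat \<Rightarrow> nat) \<Rightarrow> (nat \<Rightarrow> nat)" where
  "one_times u = (\<lambda>i. if i = 0 then 0 else if i = 1 then 1 else u (i - 1) + 1)"

text \<open>
  The recursion holds unconditionally because it is tail-recursive. For \<open>u permutes {1..n}\<close> and
  \<open>1 \<le> k \<le> n\<close> it stops after at most one recursive call: the largest \<open>i \<le> k\<close> with
  \<open>one_times u i < one_times u (k + 1)\<close> lies in \<open>I_set (one_times u) (k + 1)\<close>.
\<close>

partial_function (tailrec) Phi :: "(nat \<Rightarrow> nat) \<Rightarrow> nat \<Rightarrow> (nat \<Rightarrow> nat) set" where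
  "Phi u k =
    (if I_set u k \<noteq> {} then {swap_pos u i k | i. i \<in> I_set u k}
     else Phi (one_times u) (k + 1))"

definition simple_transp :: "nat \<Rightarrow> (nat \<Rightarrow> nat)" where
  "simple_transp i = transpose i (i + 1)"

definition word_prod :: "nat list \<Rightarrow> (nat \<Rightarrow> nat)" where
  "word_prod as = foldr (\<circ>) (map simple_transp as) id"

definition reduced_words :: "(nat \<Rightarrow> nat) \<Rightarrow> nat list set" where
  "reduced_words w =
    {as. (\<forall>a\<in>set as. 1 \<le> a) \<and> word_prod as = w \<and> length as = inv_count w}"

definition compatible :: "nat list \<Rightarrow> nat list \<Rightarrow> bool" where
  "compatible as bs \<longleftrightarrow>
    length bs = length as \<and> (\<forall>b\<in>set bs. 1 \<le> b) \<and> sorted bs \<and>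
    (\<forall>i. Suc i < length as \<longrightarrow> as ! i < as ! Suc i \<longrightarrow> bs ! i < bs ! Suc i)"

text \<open>
  A formal power series in $x_1, x_2, \ldots$ is given by its coefficients; the monomial
  $x_{b_1} \cdots x_{b_l}$ is indexed by the multiset of its variable indices. Addition is the
  pointwise one of \<^theory>\<open>HOL-Library.Function_Algebras\<close>. Both index sets in \<open>stanley\<close> are
  finite for \<open>w permutes {1..n}\<close>: the letters of a reduced word of \<open>w\<close> are less than \<open>n\<close>, and
  only finitely many lists have a given multiset of entries.
\<close>

type_synonym power_series = "nat multiset \<Rightarrow> int"

definition stanley :: "(nat \<Rightarrow> nat) \<Rightarrow> power_series" where
  "stanley w =
    (\<lambda>m. \<Sum>as\<in>reduced_words w. int (card {bs. compatible as bs \<and> mset bs = m}))"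

definition contains_132 :: "nat \<Rightarrow> (nat \<Rightarrow> nat) \<Rightarrow> bool" where
  "contains_132 n w \<longleftrightarrow>
    (\<exists>i t j. 1 \<le> i \<and> i < t \<and> t < j \<and> j \<le> n \<and> w i < w j \<and> w j < w t)"

end

theory Submission
  imports Defs
begin

text \<open>
  Let $D_a w = s_a w$ if $\ell(s_a w) < \ell(w)$ and $D_a w = 0$ otherwise. Then $F_w$ is the
  coefficient of the identity in $\cdots A(x_2) A(x_1) w$, where
  $A(x) = (1 + x D_1) \cdots (1 + x D_{n-1})$. Let
  $T_k w = \sum_{c > k} w t_{k,c} - \sum_{c < k} w t_{c,k}$, summed over the terms of length
  $\ell(w) + 1$. The commutator $[D_a, T_k]$ is diagonal, with entry $[w_k = a] - [w_k = a + 1]$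
  at \<open>w\<close>, so the commutator of $A(x)$ with $T_k$ telescopes to boundary terms supported on
  $w_k = 1$ and $w_k = n$. If $u_i < u_k < u_j$ for some $i < k < j$, the same holds for every
  permutation reached from \<open>u\<close> by the $D_a$, because these only remove inversions (in positions);
  hence the boundary terms vanish. Since $T_k v$ never involves the identity, $F_{T_k u} = 0$. The
  choice of \<open>p\<close> and \<open>q\<close> makes \<open>q\<close> the only $c > p$ in $T_p u$ for $u = w t_{p,q}$.
\<close>

subsection \<open>Inversions and covers in Bruhat order\<close>

text \<open>The usual positional criterion for a Bruhat cover; \<open>inv_count_swap_pos_Suc\<close>
  ties it to length.\<close>

definition covers :: "(nat \<Rightarrow> nat) \<Rightarrow> nat \<Rightarrow> nat \<Rightarrow> bool" where
  "covers w i j \<longleftrightarrow> i < j \<and> w i < w j \<and> (\<forall>c. i < c \<and> c < j \<longrightarrow> \<not> (w i < w c \<and> w c < w j))"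

text \<open>The coefficient of \<open>swap_pos w k c\<close> in $T_k w$, so that a single sum over
  all \<open>c\<close> treats both signs.\<close>

definition cover_sign :: "nat \<Rightarrow> (nat \<Rightarrow> nat) \<Rightarrow> nat \<Rightarrow> int" where
  "cover_sign k w c = (if covers w k c then 1 else if covers w c k then -1 else 0)"

text \<open>The condition for $D_a w$ to be nonzero, put as a comparison of the positions of two
  adjacent values; \<open>inv_count_simple_transp_comp\<close> relates it to length.\<close>

definition left_descent :: "nat \<Rightarrow> (nat \<Rightarrow> nat) \<Rightarrow> bool" where
  "left_descent a w \<longleftrightarrow> inv w (Suc a) < inv w a"

definition inversions :: "(nat \<Rightarrow> nat) \<Rightarrow> (nat \<times> nat) set" where
  "inversions u = {(i, j). 1 \<le> i \<and> i < j \<and> u j < u i}"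

lemma finite_inversions:
  assumes "u permutes {1..n}" shows "finite (inversions u)"
proof (rule finite_subset)
  show "inversions u \<subseteq> {1..n} \<times> {1..n}"
  proof clarify
    fix i j assume "(i, j) \<in> inversions u"
    then have ij: "1 \<le> i" "i < j" "u j < u i" by (auto simp: inversions_def)
    have "j \<le> n"
    proof (rule ccontr)
      assume "\<not> j \<le> n"
      then have "u j = j" using assms by (simp add: permutes_not_in)
      moreover from this have "u i \<le> n \<or> u i = i"
        using permutes_in_image[OF assms, of i] permutes_not_in[OF assms, of i] by auto
      ultimately show False using ij \<open>\<not> j \<le> n\<close> by auto
    qed
    then show "i \<in> {1..n} \<and> j \<in> {1..n}" using ij by auto
  qed
qed simp

lemma swap_pos_permutes:
  "w permutes S \<Longrightarrow> i \<in> S \<Longrightarrow> j \<in> S \<Longrightarrow> swap_pos w i j permutes S"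
  unfolding swap_pos_def by (rule permutes_compose[OF permutes_swap_id])

lemma swap_pos_twice: "swap_pos (swap_pos w i j) i j = w"
  by (simp add: swap_pos_def comp_assoc)

text \<open>
  The map \<open>f\<close> relabels positions by the transposition whenever this keeps the two positions in
  order. It is an involution on all pairs, so it embeds the old inversions into the new ones.
\<close>

lemma inversions_swap_pos:
  assumes w: "inj w" and ij: "1 \<le> i" "i < j" "w i < w j"
  defines "f \<equiv> \<lambda>(c, d). if c < d \<and> transpose i j c < transpose i j d
    then (transpose i j c, transpose i j d) else (c, d)"
  shows "inversions (swap_pos w i j) = f ` inversions w \<union> {(i, j)} \<union>
      (\<Union>c\<in>{c. i < c \<and> c < j \<and> w i < w c \<and> w c < w j}. {(i, c), (c, j)})"
    and "inj_on f (inversions w)" and "(i, j) \<notin> f ` inversions w"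
    and "\<And>c. i < c \<Longrightarrow> c < j \<Longrightarrow> w i < w c \<Longrightarrow> w c < w j \<Longrightarrow> (i, c) \<notin> f ` inversions w"
proof -
  have ff: "f (f z) = z" for z
    by (cases z) (simp add: f_def)
  have mem: "z \<in> f ` A \<longleftrightarrow> f z \<in> A" for z A
    using ff by (metis image_iff)
  show "inj_on f (inversions w)" by (metis ff inj_onI)
  show "(i, j) \<notin> f ` inversions w" unfolding mem using ij by (auto simp: f_def inversions_def)
  show "\<And>c. i < c \<Longrightarrow> c < j \<Longrightarrow> w i < w c \<Longrightarrow> w c < w j \<Longrightarrow> (i, c) \<notin> f ` inversions w"
    unfolding mem using ij by (auto simp: f_def inversions_def transpose_def)
  show "inversions (swap_pos w i j) = f ` inversions w \<union> {(i, j)} \<union>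
      (\<Union>c\<in>{c. i < c \<and> c < j \<and> w i < w c \<and> w c < w j}. {(i, c), (c, j)})"
  proof (rule set_eqI, clarify)
    fix c d
    let ?M = "{c. i < c \<and> c < j \<and> w i < w c \<and> w c < w j}"
    have "(c, d) \<in> inversions (swap_pos w i j) \<longleftrightarrow>
      f (c, d) \<in> inversions w \<or> c = i \<and> d = j \<or> c = i \<and> d \<in> ?M \<or> d = j \<and> c \<in> ?M"
    proof (cases "c < d")
      case False
      then show ?thesis using ij by (auto simp: inversions_def f_def)
    next
      case True
      then have t: "transpose i j c < transpose i j d \<longleftrightarrow> \<not> (c = i \<and> d \<le> j \<or> d = j \<and> i \<le> c)"
        using ij by (auto simp: transpose_def)
      show ?thesis
      proof (cases "transpose i j c < transpose i j d")
        case tt: True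
        have "1 \<le> transpose i j c \<longleftrightarrow> 1 \<le> c" using ij by (auto simp: transpose_def)
        then show ?thesis using True tt t by (auto simp: inversions_def f_def swap_pos_def)
      next
        case False
        \<comment> \<open>On these pairs \<open>f\<close> is the identity. In the last two cases the
          middle value is compared with the other end value after the swap, so the gain is exactly
          \<open>?M\<close>.\<close>
        then consider "c = i" "d = j" | "c = i" "i < d" "d < j" | "d = j" "i < c" "c < j"
          using True t by force
        then show ?thesis
        proof cases
          case 1
          then show ?thesis using ij by (simp add: inversions_def swap_pos_def)
        next
          case 2
          then have "w d \<noteq> w i" "w d \<noteq> w j" using w by (auto simp: inj_eq)
          then show ?thesis using 2 ij by (auto simp: inversions_def f_def swap_pos_def)
        next
          case 3
          then have "w c \<noteq> w i" "w c \<noteq> w j" using w by (auto simp: inj_eq)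
          then show ?thesis using 3 ij by (auto simp: inversions_def f_def swap_pos_def)
        qed
      qed
    qed
    moreover have "(c, d) \<in> (\<Union>c\<in>?M. {(i, c), (c, j)}) \<longleftrightarrow> c = i \<and> d \<in> ?M \<or> d = j \<and> c \<in> ?M"
      by auto
    ultimately show "((c, d) \<in> inversions (swap_pos w i j)) = ((c, d) \<in> f ` inversions w \<union> {(i, j)} \<union>
      (\<Union>c\<in>?M. {(i, c), (c, j)}))"
      unfolding Un_iff mem by simp
  qed
qed

lemma inv_count_eq: "inv_count u = card (inversions u)"
  by (simp add: inv_count_def inversions_def)

text \<open>The old inversions embed and \<open>(i, j)\<close> is new, so the length grows. Any
  \<open>c\<close> in \<open>M\<close> yields a further inversion \<open>(i, c)\<close>, so the
  growth is one only if \<open>M\<close> is empty.\<close>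

lemma inv_count_swap_pos:
  assumes w: "w permutes {1..n}" and ij: "1 \<le> i" "i < j" "w i < w j"
  shows inv_count_swap_pos_gt: "inv_count w < inv_count (swap_pos w i j)"
    and inv_count_swap_pos_Suc:
      "inv_count (swap_pos w i j) = inv_count w + 1 \<longleftrightarrow> covers w i j"
proof -
  define f where "f = (\<lambda>(c, d). if c < d \<and> transpose i j c < transpose i j d
    then (transpose i j c, transpose i j d) else (c, d))"
  define M where "M = {c. i < c \<and> c < j \<and> w i < w c \<and> w c < w j}"
  have "inj w" using w permutes_inj by blast
  note sw = inversions_swap_pos[OF this ij, folded f_def, folded M_def]
  have fin: "finite (inversions w)" by (rule finite_inversions[OF w])
  have finM: "finite M" by (rule finite_subset[of _ "{..j}"]) (auto simp: M_def)
  have c1: "card (insert (i, j) (f ` inversions w)) = inv_count w + 1"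
    using fin sw(2,3) by (simp add: card_image inv_count_eq)
  have finS: "finite (inversions (swap_pos w i j))" unfolding sw(1) using fin finM by auto
  have "card (insert (i, j) (f ` inversions w)) \<le> inv_count (swap_pos w i j)"
    unfolding inv_count_eq using finS by (intro card_mono) (auto simp: sw(1))
  then show "inv_count w < inv_count (swap_pos w i j)" using c1 by simp
  have cov: "covers w i j \<longleftrightarrow> M = {}" using ij by (auto simp: covers_def M_def)
  show "inv_count (swap_pos w i j) = inv_count w + 1 \<longleftrightarrow> covers w i j"
  proof (cases "M = {}")
    case True
    then show ?thesis using c1 cov by (simp add: inv_count_eq sw(1))
  next
    case False
    then obtain c where c: "c \<in> M" by auto
    have "(i, c) \<notin> insert (i, j) (f ` inversions w)" using c sw(4) by (auto simp: M_def)
    moreover have "(i, c) \<in> inversions (swap_pos w i j)" using c by (auto simp: sw(1))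
    ultimately have "insert (i, j) (f ` inversions w) \<subset> inversions (swap_pos w i j)"
      by (auto simp: sw(1))
    then have "inv_count w + 1 < inv_count (swap_pos w i j)"
      using finS c1 unfolding inv_count_eq by (metis psubset_card_mono)
    then show ?thesis using False cov by simp
  qed
qed

lemma inv_count_swap_pos_less:
  assumes w: "w permutes {1..n}" and ij: "1 \<le> i" "i < j" "j \<le> n" "w j < w i"
  shows "inv_count (swap_pos w i j) < inv_count w"
proof -
  have "swap_pos w i j permutes {1..n}" using w ij by (intro swap_pos_permutes) auto
  from inv_count_swap_pos_gt[OF this ij(1,2)] show ?thesis
    using ij by (simp add: swap_pos_twice) (simp add: swap_pos_def)
qed

lemma inv_count_swap_pos_iff_covers:
  assumes w: "w permutes {1..n}" and ij: "1 \<le> i" "i < j" "j \<le> n"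
  shows "inv_count (swap_pos w i j) = inv_count w + 1 \<longleftrightarrow> covers w i j"
proof (cases "w i < w j")
  case True
  then show ?thesis using assms inv_count_swap_pos_Suc by blast
next
  case False
  moreover have "w i \<noteq> w j" using permutes_inj[OF w] ij by (simp add: inj_eq)
  ultimately have "w j < w i" by simp
  then show ?thesis using inv_count_swap_pos_less[OF assms] by (auto simp: covers_def)
qed

section \<open>Left multiplication by a simple transposition, read in positions\<close>

lemma left_descent_iff:
  assumes "inj w" "w x = a" "w y = Suc a"
  shows "left_descent a w \<longleftrightarrow> y < x"
  using inv_f_eq[OF assms(1,2)] inv_f_eq[OF assms(1,3)] by (simp add: left_descent_def)

text \<open>Exchanging two adjacent values affects no comparison except the one between their own
  positions.\<close>

lemma simple_transp_less_iff:
  assumes "inj w" "w x = a" "w y = Suc a"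
  shows "simple_transp a (w i) < simple_transp a (w j) \<longleftrightarrow>
    w i < w j \<and> \<not> (i = x \<and> j = y) \<or> i = y \<and> j = x"
proof -
  have "w i = a \<longleftrightarrow> i = x" "w i = Suc a \<longleftrightarrow> i = y" "w j = a \<longleftrightarrow> j = x" "w j = Suc a \<longleftrightarrow> j = y"
    using assms(2,3) inj_eq[OF assms(1)] by metis+
  then show ?thesis using assms by (auto simp: simple_transp_def transpose_def)
qed

lemma simple_transp_comp:
  assumes "inj w" "w x = a" "w y = Suc a"
  shows "simple_transp a \<circ> w = swap_pos w x y"
proof
  fix z
  have "w z = a \<longleftrightarrow> z = x" "w z = Suc a \<longleftrightarrow> z = y"
    using assms(2,3) inj_eq[OF assms(1)] by metis+
  then show "(simple_transp a \<circ> w) z = swap_pos w x y z"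
    using assms(2,3) by (simp add: simple_transp_def swap_pos_def transpose_def)
qed

subsection \<open>The commutator with left multiplication\<close>

text \<open>Comparing \<open>transpose i j y\<close> with \<open>transpose i j x\<close> asks
  whether \<open>a\<close> is a left descent after the swap, so this is the vanishing of the
  off-diagonal part of the commutator. If one of \<open>i\<close>, \<open>j\<close> is
  \<open>x\<close> or \<open>y\<close>, the other position of that pair cannot lie between them,
  since its value would obstruct the cover of \<open>w\<close> (cases 1 and 4) or of $s_a w$ (cases
  2 and 3).\<close>

lemma covers_left_mult:
  assumes w: "inj w" and xy: "w x = a" "w y = Suc a" and ij: "i < j"
    and n: "\<not> (i = x \<and> j = y)" "\<not> (i = y \<and> j = x)"
  shows "covers w i j \<and> transpose i j y < transpose i j x \<longleftrightarrow>
    y < x \<and> covers (simple_transp a \<circ> w) i j"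
proof -
  have "x \<noteq> y" using xy by auto
  have s: "(simple_transp a \<circ> w) c < (simple_transp a \<circ> w) d \<longleftrightarrow>
    w c < w d \<and> \<not> (c = x \<and> d = y) \<or> c = y \<and> d = x" for c d
    using simple_transp_less_iff[OF w xy] by simp
  \<comment> \<open>No value lies strictly between \<open>a\<close> and
    \<open>Suc a\<close>.\<close>
  have sx: "w c < w y \<longleftrightarrow> w c < w x \<or> c = x" "w x < w c \<longleftrightarrow> w y < w c \<or> c = y" for c
    using xy inj_eq[OF w, of c x] inj_eq[OF w, of c y] by linarith+
  have cov: "covers (simple_transp a \<circ> w) i j \<longleftrightarrow> w i < w j \<and> (\<forall>c. i < c \<and> c < j \<longrightarrow> \<not>
    ((w i < w c \<and> \<not> (i = x \<and> c = y) \<or> i = y \<and> c = x) \<and>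
     (w c < w j \<and> \<not> (c = x \<and> j = y) \<or> c = y \<and> j = x)))"
    unfolding covers_def s using ij n by auto
  have covw: "covers w i j \<longleftrightarrow> w i < w j \<and> (\<forall>c. i < c \<and> c < j \<longrightarrow> \<not> (w i < w c \<and> w c < w j))"
    using ij by (simp add: covers_def)
  consider "i = x" "j \<noteq> y" | "i = y" "j \<noteq> x" | "j = x" "i \<noteq> y" | "j = y" "i \<noteq> x"
    | "i \<noteq> x" "i \<noteq> y" "j \<noteq> x" "j \<noteq> y" using n by blast
  then show ?thesis
  proof cases
    case 1
    have "covers w i j \<Longrightarrow> \<not> (i < y \<and> y < j)"
      unfolding covw using 1 xy sx(2)[of j] by auto
    then have "covers w i j \<Longrightarrow> y < j \<longleftrightarrow> y < x" using 1 ij \<open>x \<noteq> y\<close> by auto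
    moreover have "y < x \<Longrightarrow> covers w i j \<longleftrightarrow> covers (simple_transp a \<circ> w) i j"
      unfolding covw cov using 1 ij by auto
    ultimately show ?thesis using 1 \<open>x \<noteq> y\<close> by auto
  next
    case 2
    have "covers (simple_transp a \<circ> w) i j \<Longrightarrow> y < x \<Longrightarrow> j < x"
      unfolding cov using 2 xy sx(2)[of j] by (metis Suc_lessD linorder_neqE_nat)
    moreover have "j < x \<Longrightarrow> covers w i j \<longleftrightarrow> covers (simple_transp a \<circ> w) i j"
      unfolding covw cov using 2 by auto
    ultimately show ?thesis using 2 ij \<open>x \<noteq> y\<close> by auto
  next
    case 3
    have "covers (simple_transp a \<circ> w) i j \<Longrightarrow> y < x \<Longrightarrow> y < i"
      unfolding cov using 3 xy by (metis less_SucI linorder_neqE_nat)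
    moreover have "y < i \<Longrightarrow> covers w i j \<longleftrightarrow> covers (simple_transp a \<circ> w) i j"
      unfolding covw cov using 3 by auto
    ultimately show ?thesis using 3 ij \<open>x \<noteq> y\<close> by auto
  next
    case 4
    have "covers w i j \<Longrightarrow> \<not> (i < x \<and> x < j)"
      unfolding covw using 4 xy sx(1)[of i] by auto
    then have "covers w i j \<Longrightarrow> i < x \<longleftrightarrow> y < x" using 4 ij \<open>x \<noteq> y\<close> by auto
    moreover have "y < x \<Longrightarrow> covers w i j \<longleftrightarrow> covers (simple_transp a \<circ> w) i j"
      unfolding covw cov using 4 ij by auto
    ultimately show ?thesis using 4 \<open>x \<noteq> y\<close> by auto
  next
    case 5
    then have "covers w i j \<longleftrightarrow> covers (simple_transp a \<circ> w) i j"
      unfolding covw cov by auto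
    then show ?thesis using 5 by auto
  qed
qed

text \<open>
  The coefficient of $s_a w t_{k,c}$ in $D_a T_k w - T_k D_a w = ([w_k = a] - [w_k = a + 1])\, w$.
\<close>

lemma cover_sign_commutator:
  assumes w: "inj w" and xy: "w x = a" "w y = Suc a"
  shows "cover_sign k w c * of_bool (left_descent a (swap_pos w k c)) =
    of_bool (left_descent a w) * cover_sign k (simple_transp a \<circ> w) c
    + (of_bool (k = x \<and> c = y) - of_bool (k = y \<and> c = x))"
proof -
  have "x \<noteq> y" using xy by auto
  have "inj (swap_pos w k c)" using w by (simp add: swap_pos_def inj_compose)
  moreover have "swap_pos w k c (transpose k c x) = a" "swap_pos w k c (transpose k c y) = Suc a"
    using xy by (auto simp: swap_pos_def)
  ultimately have d: "left_descent a (swap_pos w k c) \<longleftrightarrow> transpose k c y < transpose k c x"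
    by (rule left_descent_iff)
  have d': "left_descent a w \<longleftrightarrow> y < x" using assms by (rule left_descent_iff)
  \<comment> \<open>These covers produce the diagonal terms: if \<open>x < y\<close>, the product
    $s_a w$ is a term of $T_k w$ for \<open>k\<close> equal to \<open>x\<close> or \<open>y\<close>;
    if \<open>y < x\<close>, then \<open>w\<close> is a term of $T_k D_a w$.\<close>
  have xy_cov: "covers w x y" if "x < y" using that xy by (auto simp: covers_def)
  have yx_cov: "covers (simple_transp a \<circ> w) y x" if "y < x"
    using that xy by (auto simp: covers_def simple_transp_def transpose_def)
  have n: "\<not> covers w y x" "\<not> covers (simple_transp a \<circ> w) x y"
    using xy by (auto simp: covers_def simple_transp_def)
  consider "k = c" | "{k, c} = {x, y}" | "k < c" "{k, c} \<noteq> {x, y}" | "c < k" "{k, c} \<noteq> {x, y}"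
    by fastforce
  then show ?thesis
  proof cases
    case 1
    then show ?thesis using \<open>x \<noteq> y\<close> by (auto simp: cover_sign_def covers_def)
  next
    case 2
    then consider "k = x" "c = y" | "k = y" "c = x" by (auto simp: doubleton_eq_iff)
    then show ?thesis
      using xy_cov yx_cov n \<open>x \<noteq> y\<close> unfolding cover_sign_def d d'
      by cases (cases "x < y"; auto simp: covers_def)+
  next
    case 3
    then have "\<not> covers u c k" for u by (auto simp: covers_def)
    then show ?thesis using 3 covers_left_mult[OF w xy, of k c]
      unfolding cover_sign_def d d' by (auto simp: of_bool_def)
  next
    case 4
    then have "\<not> covers u k c" for u by (auto simp: covers_def)
    then show ?thesis using 4 covers_left_mult[OF w xy, of c k]
      unfolding cover_sign_def d d' by (auto simp: of_bool_def transpose_commute)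
  qed
qed
subsection \<open>Reduced words and left descents\<close>

lemma left_descent_less:
  assumes w: "w permutes {1..n}" and d: "left_descent a w"
  shows "a < n"
proof (rule ccontr)
  assume "\<not> a < n"
  then have "inv w (Suc a) = Suc a"
    using permutes_inv[OF w] by (simp add: permutes_not_in)
  moreover have "inv w a \<le> a"
    using permutes_in_image[OF permutes_inv[OF w], of a] permutes_not_in[OF permutes_inv[OF w], of a]
      \<open>\<not> a < n\<close> by (cases "a \<in> {1..n}") auto
  ultimately show False using d by (simp add: left_descent_def)
qed

lemma simple_transp_comp_permutes:
  assumes "w permutes {1..n}" "1 \<le> a" "a < n"
  shows "simple_transp a \<circ> w permutes {1..n}"
  unfolding simple_transp_def using assms by (intro permutes_compose permutes_swap_id) auto

lemma left_descent_permutes: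
  assumes "w permutes {1..n}" "1 \<le> a" "left_descent a w"
  shows "simple_transp a \<circ> w permutes {1..n}"
  using assms left_descent_less simple_transp_comp_permutes by blast

text \<open>In the shorter of \<open>w\<close> and $s_a w$ the positions of the adjacent values
  \<open>a\<close> and \<open>Suc a\<close> form a cover, as no value can come between.\<close>

lemma inv_count_simple_transp_comp:
  assumes w: "w permutes {1..n}" and a: "1 \<le> a" "a < n"
  shows "if left_descent a w then inv_count w = inv_count (simple_transp a \<circ> w) + 1
    else inv_count (simple_transp a \<circ> w) = inv_count w + 1"
proof -
  define x y where "x = inv w a" and "y = inv w (Suc a)"
  have xy: "w x = a" "w y = Suc a" by (simp_all add: x_def y_def permutes_inverses[OF w])
  have in_n: "x \<in> {1..n}" "y \<in> {1..n}"
    using a permutes_in_image[OF permutes_inv[OF w]] by (simp_all add: x_def y_def)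
  have inj: "inj w" using w by (rule permutes_inj)
  note sw = simple_transp_comp[OF inj xy]
  have d: "left_descent a w \<longleftrightarrow> y < x" by (simp add: left_descent_def x_def y_def)
  show ?thesis
  proof (cases "y < x")
    case True
    let ?v = "simple_transp a \<circ> w"
    have "?v permutes {1..n}" using w a by (rule simple_transp_comp_permutes)
    moreover have "?v y = a" "?v x = Suc a" using xy by (simp_all add: simple_transp_def)
    ultimately have "inv_count (swap_pos ?v y x) = inv_count ?v + 1"
      using True in_n by (subst inv_count_swap_pos_iff_covers) (auto simp: covers_def)
    moreover have "swap_pos ?v y x = w"
      unfolding sw by (simp add: swap_pos_def transpose_commute comp_assoc)
    ultimately show ?thesis using d True by simp
  next
    case False
    moreover have "x \<noteq> y" using xy by auto
    ultimately have "inv_count (swap_pos w x y) = inv_count w + 1"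
      using xy in_n by (subst inv_count_swap_pos_iff_covers[OF w]) (auto simp: covers_def)
    then show ?thesis using d False sw by simp
  qed
qed

lemma word_prod_Nil: "word_prod [] = id"
  unfolding word_prod_def list.map foldr.simps by (rule id_apply)

lemma word_prod_Cons: "word_prod (a # as) = simple_transp a \<circ> word_prod as"
  by (simp add: word_prod_def)

lemma word_prod_permutes: "set as \<subseteq> {1..<n} \<Longrightarrow> word_prod as permutes {1..n}"
proof (induction as)
  case Nil
  then show ?case by (simp only: word_prod_Nil permutes_id)
next
  case (Cons a as)
  then show ?case unfolding word_prod_Cons by (intro simple_transp_comp_permutes) auto
qed

lemma inv_count_id: "inv_count id = 0"
proof -
  have "{(i, j). 1 \<le> i \<and> i < j \<and> id j < (id i :: nat)} = {}" by auto
  then show ?thesis unfolding inv_count_def by (metis card.empty)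
qed

lemma inv_count_word_prod: "\<forall>a\<in>set as. 1 \<le> a \<Longrightarrow> inv_count (word_prod as) \<le> length as"
proof (induction as)
  case Nil
  then show ?case by (simp only: word_prod_Nil inv_count_id)
next
  case (Cons a as)
  define n where "n = Suc (Max (set (a # as)))"
  have n: "set (a # as) \<subseteq> {1..<n}"
    using Cons.prems by (auto simp: n_def less_Suc_eq_le simp del: Max_insert)
  then have "word_prod as permutes {1..n}" by (intro word_prod_permutes) auto
  then have "inv_count (simple_transp a \<circ> word_prod as) \<le> inv_count (word_prod as) + 1"
    using inv_count_simple_transp_comp[of "word_prod as" n a] n by (auto split: if_splits)
  also have "\<dots> \<le> length (a # as)" using Cons by simp
  finally show ?case by (simp only: word_prod_Cons)
qed

lemma simple_transp_comp_twice: "simple_transp a \<circ> (simple_transp a \<circ> w) = w"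
  by (simp add: simple_transp_def fun_eq_iff)

lemma Nil_in_reduced_words: "[] \<in> reduced_words w \<longleftrightarrow> w = id"
  unfolding reduced_words_def by (force simp only: mem_Collect_eq word_prod_Nil inv_count_id list.size list.set)

text \<open>If \<open>a\<close> is not a left descent, $s_a w$ is longer than \<open>w\<close>, and
  \<open>inv_count_word_prod\<close> rules out so short a word for it. This recursion replaces all
  later work with products.\<close>

lemma Cons_in_reduced_words:
  assumes "w permutes {1..n}"
  shows "a # as \<in> reduced_words w \<longleftrightarrow>
    1 \<le> a \<and> left_descent a w \<and> as \<in> reduced_words (simple_transp a \<circ> w)"
proof (cases "1 \<le> a")
  case True
  \<comment> \<open>The letter \<open>a\<close> may exceed \<open>n\<close>, so \<open>w\<close> is
    viewed in a symmetric group containing $s_a$.\<close>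
  define N where "N = max n (Suc a)"
  have w: "w permutes {1..N}" using assms by (rule permutes_subset) (auto simp: N_def)
  have len: "if left_descent a w then inv_count w = inv_count (simple_transp a \<circ> w) + 1
    else inv_count (simple_transp a \<circ> w) = inv_count w + 1"
    by (rule inv_count_simple_transp_comp[OF w True]) (simp add: N_def)
  have eq: "word_prod (a # as) = w \<longleftrightarrow> word_prod as = simple_transp a \<circ> w"
    unfolding word_prod_Cons by (metis simple_transp_comp_twice)
  show ?thesis
    using True len inv_count_word_prod[of as] eq by (auto simp: reduced_words_def split: if_splits)
qed (auto simp: reduced_words_def)

lemma reduced_words_letters:
  "w permutes {1..n} \<Longrightarrow> as \<in> reduced_words w \<Longrightarrow> set as \<subseteq> {1..<n}"
proof (induction as arbitrary: w)
  case (Cons a as)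
  then have "1 \<le> a" "left_descent a w" "as \<in> reduced_words (simple_transp a \<circ> w)"
    by (simp_all add: Cons_in_reduced_words)
  with Cons left_descent_permutes left_descent_less show ?case by fastforce
qed simp

text \<open>Once a left descent \<open>a\<close> has been removed, \<open>a\<close> is no longer a
  left descent.\<close>

lemma reduced_words_adjacent:
  "w permutes {1..n} \<Longrightarrow> as \<in> reduced_words w \<Longrightarrow> Suc i < length as \<Longrightarrow> as ! i \<noteq> as ! Suc i"
proof (induction as arbitrary: w i)
  case (Cons a as)
  then have a: "1 \<le> a" "left_descent a w" and as: "as \<in> reduced_words (simple_transp a \<circ> w)"
    by (simp_all add: Cons_in_reduced_words)
  have v: "simple_transp a \<circ> w permutes {1..n}" using Cons.prems(1) a by (rule left_descent_permutes)
  show ?case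
  proof (cases i)
    case 0
    then obtain a' as' where as': "as = a' # as'" using Cons.prems by (cases as) auto
    then have "left_descent a' (simple_transp a \<circ> w)" using as v by (simp add: Cons_in_reduced_words)
    moreover have "\<not> left_descent a (simple_transp a \<circ> w)"
      using inv_count_simple_transp_comp[OF Cons.prems(1), of a]
        inv_count_simple_transp_comp[OF v, of a] a left_descent_less[OF Cons.prems(1)]
      by (simp add: simple_transp_comp_twice split: if_splits)
    ultimately show ?thesis using 0 as' by auto
  next
    case (Suc i')
    then show ?thesis using Cons.IH[OF v as, of i'] Cons.prems by simp
  qed
qed simp

text \<open>
  The coefficient of the monomial \<open>m\<close> in $\langle \prod_{(b,a) \in L} (1 + x_b D_a) w, \mathrm{id}\rangle$,
  the factors being applied to \<open>w\<close> from the first entry of \<open>L\<close> to the last.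
\<close>

definition word_count :: "(nat \<times> nat) list \<Rightarrow> (nat \<Rightarrow> nat) \<Rightarrow> nat multiset \<Rightarrow> int" where
  "word_count L w m =
    int (card {ps \<in> set (subseqs L). map snd ps \<in> reduced_words w \<and> mset (map fst ps) = m})"

lemma word_count_Nil: "word_count [] w m = of_bool (w = id \<and> m = {#})"
proof -
  have "{ps \<in> set (subseqs []). map snd ps \<in> reduced_words w \<and> mset (map fst ps) = m}
    = (if w = id \<and> m = {#} then {[]} else {})"
    by (auto simp: Nil_in_reduced_words)
  then show ?thesis by (simp add: word_count_def)
qed

text \<open>The two summands come from skipping or using the entry \<open>(b, a)\<close>. As the
  count is over a set of subsequences, the entry must not recur in \<open>L\<close>, or the two
  kinds could coincide.\<close>

lemma word_count_Cons:
  assumes w: "w permutes {1..n}" and a: "1 \<le> a" and L: "(b, a) \<notin> set L"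
  shows "word_count ((b, a) # L) w m = word_count L w m +
    of_bool (b \<in># m) * of_bool (left_descent a w) * word_count L (simple_transp a \<circ> w) (m - {#b#})"
proof -
  define S :: "(nat \<times> nat) list \<Rightarrow> (nat \<Rightarrow> nat) \<Rightarrow> nat multiset \<Rightarrow> (nat \<times> nat) list set"
    where "S L w m = {ps \<in> set (subseqs L). map snd ps \<in> reduced_words w \<and> mset (map fst ps) = m}" for L w m
  have wc: "word_count L w m = int (card (S L w m))" for L w m by (simp add: word_count_def S_def)
  have fin: "finite (S L w m)" for L w m by (simp add: S_def)
  have mem: "(b, a) # ps \<notin> set (subseqs L)" for ps
    using L subseqs_powset[of L] by (metis Pow_iff image_eqI list.set_intros(1) subsetD)
  \<comment> \<open>The membership test matters because \<open>m - {#b#}\<close> is \<open>m\<close>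
    itself when \<open>b\<close> is absent.\<close>
  have m: "add_mset b M = m \<longleftrightarrow> b \<in># m \<and> M = m - {#b#}" for M by auto
  have "S ((b, a) # L) w m = S L w m \<union>
      (if b \<in># m \<and> left_descent a w
       then (#) (b, a) ` S L (simple_transp a \<circ> w) (m - {#b#}) else {})"
    using a by (auto simp: S_def Let_def Cons_in_reduced_words[OF w] m)
  moreover have "S L w m \<inter> (#) (b, a) ` X = {}" for X using mem by (auto simp: S_def)
  ultimately show ?thesis
    unfolding wc by (auto simp: card_Un_disjoint fin card_image)
qed

subsection \<open>The Stanley symmetric function as a count of subwords\<close>

text \<open>The letters descend because entries act from first to last and the factor of $A(x_b)$
  with the largest letter acts first.\<close>

primrec letters :: "nat \<Rightarrow> nat \<Rightarrow> (nat \<times> nat) list" where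
  "letters b 0 = []"
| "letters b (Suc a) = (b, Suc a) # letters b a"

text \<open>The infinite product of the $A(x_c)$, truncated to \<open>r\<close> variables starting
  with $x_b$.\<close>

primrec alphabet :: "nat \<Rightarrow> nat \<Rightarrow> nat \<Rightarrow> (nat \<times> nat) list" where
  "alphabet n 0 b = []"
| "alphabet n (Suc r) b = letters b (n - 1) @ alphabet n r (Suc b)"

lemma set_letters: "set (letters b a) = {b} \<times> {1..a}"
proof (induction a)
  case (Suc a)
  have "{1..Suc a} = insert (Suc a) {1..a}" by (rule atLeastAtMostSuc_conv) simp
  with Suc show ?case by simp
qed simp

lemma set_alphabet: "set (alphabet n r b) = {b..<b + r} \<times> {1..n - 1}"
proof (induction r arbitrary: b)
  case (Suc r)
  have "{b..<b + Suc r} = insert b {Suc b..<Suc b + r}" by auto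
  with Suc show ?case by (simp only: alphabet.simps set_append set_letters) blast
qed simp

text \<open>
  A pair \<open>(b, a)\<close> is a letter \<open>a\<close> carrying the variable $x_b$. A reduced word has no two equal adjacent
  letters, so for it compatibility says exactly that the pairs increase in this order.
\<close>

definition letter_less :: "nat \<times> nat \<Rightarrow> nat \<times> nat \<Rightarrow> bool" where
  "letter_less x y \<longleftrightarrow> fst x < fst y \<or> fst x = fst y \<and> snd y < snd x"

lemma transp_letter_less: "transp letter_less"
  by (auto simp: transp_def letter_less_def)

lemma sorted_letters: "sorted_wrt letter_less (letters b a)"
  by (induction a) (auto simp: letter_less_def set_letters)

lemma sorted_alphabet: "sorted_wrt letter_less (alphabet n r b)"
  by (induction r arbitrary: b)
    (auto simp: sorted_wrt_append sorted_letters set_letters set_alphabet letter_less_def)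

text \<open>A strictly increasing list has no repetitions, and any subset of its entries can be
  listed increasingly in just one way.\<close>

lemma subseqs_sorted_iff:
  assumes "sorted_wrt letter_less L"
  shows "ps \<in> set (subseqs L) \<longleftrightarrow> sorted_wrt letter_less ps \<and> set ps \<subseteq> set L"
  using assms
proof (induction L arbitrary: ps)
  case (Cons x L)
  have irr: "\<not> letter_less z z" for z by (simp add: letter_less_def)
  have asym: "letter_less y z \<Longrightarrow> \<not> letter_less z y" for y z by (auto simp: letter_less_def)
  have ps: "ps \<in> set (subseqs (x # L)) \<longleftrightarrow>
    (\<exists>ps'. ps = x # ps' \<and> ps' \<in> set (subseqs L)) \<or> ps \<in> set (subseqs L)"
    by (auto simp: Let_def)
  have IH: "ps \<in> set (subseqs L) \<longleftrightarrow> sorted_wrt letter_less ps \<and> set ps \<subseteq> set L" for ps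
    using Cons by simp
  have x: "\<forall>y\<in>set L. letter_less x y" using Cons.prems by simp
  show ?case
  proof (cases "\<exists>ps'. ps = x # ps'")
    case True
    then obtain ps' where ps': "ps = x # ps'" by blast
    have "x \<notin> set L" using x irr by blast
    moreover have "x \<notin> set ps'" if "sorted_wrt letter_less ps" using that irr[of x] by (auto simp: ps')
    ultimately show ?thesis unfolding ps IH using x by (auto simp: ps')
  next
    case False
    \<comment> \<open>If \<open>x\<close> occurred after the first entry \<open>y\<close> of
      \<open>ps\<close>, then \<open>y\<close> would precede \<open>x\<close>; but \<open>x\<close>
      precedes all of \<open>L\<close>.\<close>
    have "x \<notin> set ps" if "sorted_wrt letter_less ps" "set ps \<subseteq> set (x # L)"
    proof
      assume "x \<in> set ps"
      obtain y qs where y: "ps = y # qs" using \<open>x \<in> set ps\<close> by (cases ps) auto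
      then have "x \<noteq> y" using False by blast
      then have "letter_less y x" "letter_less x y" using that \<open>x \<in> set ps\<close> x by (auto simp: y)
      then show False using asym by blast
    qed
    then show ?thesis unfolding ps IH using False by auto
  qed
qed auto

lemma sorted_zip_compatible:
  assumes "length as = length bs"
  shows "sorted_wrt letter_less (zip bs as) \<longleftrightarrow> (\<forall>i. Suc i < length as \<longrightarrow>
    bs ! i < bs ! Suc i \<or> bs ! i = bs ! Suc i \<and> as ! Suc i < as ! i)"
  using assms by (auto simp: sorted_wrt_iff_nth_Suc_transp[OF transp_letter_less] letter_less_def)

lemma compatible_iff_sorted:
  assumes w: "w permutes {1..n}" and as: "as \<in> reduced_words w" and len: "length bs = length as"
  shows "compatible as bs \<longleftrightarrow> (\<forall>b\<in>set bs. 1 \<le> b) \<and> sorted_wrt letter_less (zip bs as)"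
proof -
  have "(bs ! i \<le> bs ! Suc i \<and> (as ! i < as ! Suc i \<longrightarrow> bs ! i < bs ! Suc i)) \<longleftrightarrow>
      (bs ! i < bs ! Suc i \<or> bs ! i = bs ! Suc i \<and> as ! Suc i < as ! i)" if "Suc i < length as" for i
    using reduced_words_adjacent[OF w as that] by auto
  then show ?thesis
    unfolding sorted_zip_compatible[OF len[symmetric]] compatible_def sorted_iff_nth_Suc
    using len by auto
qed

text \<open>A monomial in the first \<open>r\<close> variables does not see the truncation. Zipping
  a reduced word with its compatible sequence gives an increasing list of pairs, that is, a
  subsequence of the alphabet.\<close>

lemma stanley_eq_word_count:
  assumes w: "w permutes {1..n}" and m: "\<forall>b\<in>#m. b \<le> r"
  shows "stanley w m = word_count (alphabet n r 1) w m"
proof -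
  let ?B = "\<lambda>as. {bs. compatible as bs \<and> mset bs = m}"
  let ?S = "{ps \<in> set (subseqs (alphabet n r 1)). map snd ps \<in> reduced_words w \<and> mset (map fst ps) = m}"
  have "finite (reduced_words w)"
  proof (rule finite_subset)
    show "reduced_words w \<subseteq> {as. set as \<subseteq> {1..<n} \<and> length as = inv_count w}"
      using reduced_words_letters[OF w] by (auto simp: reduced_words_def)
  qed (simp add: finite_lists_length_eq)
  moreover have "finite (?B as)" for as
    by (rule finite_subset[OF _ finite_permutations_of_multiset[of m]])
      (auto simp: permutations_of_multiset_def)
  ultimately have "stanley w m = int (card (SIGMA as:reduced_words w. ?B as))"
    by (simp add: stanley_def)
  also have "bij_betw (\<lambda>(as, bs). zip bs as) (SIGMA as:reduced_words w. ?B as) ?S"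
  proof (rule bij_betw_byWitness[where f' = "\<lambda>ps. (map snd ps, map fst ps)"])
    show "\<forall>z\<in>SIGMA as:reduced_words w. ?B as.
      (\<lambda>ps. (map snd ps, map fst ps)) ((\<lambda>(as, bs). zip bs as) z) = z"
      by (auto simp: compatible_def)
    show "\<forall>ps\<in>?S. (\<lambda>(as, bs). zip bs as) (map snd ps, map fst ps) = ps"
      by (simp add: zip_map_fst_snd)
    show "(\<lambda>(as, bs). zip bs as) ` (SIGMA as:reduced_words w. ?B as) \<subseteq> ?S"
    proof (rule image_subsetI)
      fix z assume "z \<in> (SIGMA as:reduced_words w. ?B as)"
      then obtain as bs where z: "z = (as, bs)" and as: "as \<in> reduced_words w"
        and c: "compatible as bs" and mb: "m = mset bs" by blast
      have len: "length bs = length as" using c by (simp add: compatible_def)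
      have s: "\<forall>b\<in>set bs. 1 \<le> b" "sorted_wrt letter_less (zip bs as)"
        using c compatible_iff_sorted[OF w as len] by auto
      have "set (zip bs as) \<subseteq> set bs \<times> set as" by (auto dest: set_zip_leftD set_zip_rightD)
      also have "\<dots> \<subseteq> set (alphabet n r 1)"
        using s(1) m mb reduced_words_letters[OF w as] unfolding set_alphabet by fastforce
      finally have "zip bs as \<in> set (subseqs (alphabet n r 1))"
        using s(2) by (simp add: subseqs_sorted_iff sorted_alphabet)
      moreover have "map snd (zip bs as) = as" "map fst (zip bs as) = bs" using len by simp_all
      ultimately have "zip bs as \<in> ?S" using as mb by (simp only: mem_Collect_eq)
      then show "(\<lambda>(as, bs). zip bs as) z \<in> ?S" by (simp only: z prod.case)
    qed
    show "(\<lambda>ps. (map snd ps, map fst ps)) ` ?S \<subseteq> (SIGMA as:reduced_words w. ?B as)"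
    proof (rule image_subsetI)
      fix ps assume "ps \<in> ?S"
      then have ps: "ps \<in> set (subseqs (alphabet n r 1))" and as: "map snd ps \<in> reduced_words w"
        and mb: "mset (map fst ps) = m" by simp_all
      have "sorted_wrt letter_less ps" "set ps \<subseteq> {1..<1 + r} \<times> {1..n - 1}"
        using ps by (simp_all add: subseqs_sorted_iff sorted_alphabet set_alphabet)
      then have "compatible (map snd ps) (map fst ps)"
        by (subst compatible_iff_sorted[OF w as]) (auto simp: zip_map_fst_snd)
      then show "(map snd ps, map fst ps) \<in> (SIGMA as:reduced_words w. ?B as)"
        using as mb by simp
    qed
  qed
  then have "card (SIGMA as:reduced_words w. ?B as) = card ?S" by (rule bij_betw_same_card)
  finally show ?thesis by (simp add: word_count_def)
qed

subsection \<open>The transition formula\<close>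

lemma sum_apply: "(\<Sum>c\<in>A. f c) x = (\<Sum>c\<in>A. f c x :: 'b :: comm_monoid_add)"
  by (induction A rule: infinite_finite_induct) auto

text \<open>
  The functional of \<open>word_count\<close> evaluated at $T_k w$ instead of \<open>w\<close>.
\<close>

definition transition ::
  "nat \<Rightarrow> nat \<Rightarrow> (nat \<times> nat) list \<Rightarrow> (nat \<Rightarrow> nat) \<Rightarrow> nat multiset \<Rightarrow> int" where
  "transition n k L w m = (\<Sum>c=1..n. cover_sign k w c * word_count L (swap_pos w k c) m)"

text \<open>Every term of $T_k w$ is longer than \<open>w\<close>, hence not the identity.\<close>

lemma transition_Nil:
  assumes w: "w permutes {1..n}" and k: "k \<in> {1..n}"
  shows "transition n k [] w m = 0"
  unfolding transition_def
proof (rule sum.neutral, rule ballI)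
  fix c assume c: "c \<in> {1..n}"
  have "swap_pos w k c \<noteq> id" if "covers w k c \<or> covers w c k"
  proof -
    have "inv_count w < inv_count (swap_pos w k c)"
      using that
    proof
      assume "covers w k c"
      then show ?thesis using k inv_count_swap_pos_gt[OF w, of k c] by (auto simp: covers_def)
    next
      assume "covers w c k"
      moreover have "swap_pos w k c = swap_pos w c k" by (simp add: swap_pos_def transpose_commute)
      ultimately show ?thesis using c inv_count_swap_pos_gt[OF w, of c k] by (auto simp: covers_def)
    qed
    then show ?thesis by (metis inv_count_id not_less0)
  qed
  then show "cover_sign k w c * word_count [] (swap_pos w k c) m = 0"
    by (auto simp: cover_sign_def word_count_Nil)
qed

text \<open>One factor $1 + x_b D_a$ is moved past $T_k$; the last summand is the diagonal
  commutator from \<open>cover_sign_commutator\<close>.\<close>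

lemma transition_Cons:
  assumes w: "w permutes {1..n}" and k: "k \<in> {1..n}" and a: "1 \<le> a" "a < n" and L: "(b, a) \<notin> set L"
  shows "transition n k ((b, a) # L) w m = transition n k L w m +
    of_bool (b \<in># m) *
      (of_bool (left_descent a w) * transition n k L (simple_transp a \<circ> w) (m - {#b#})
       + (of_bool (w k = a) - of_bool (w k = Suc a)) * word_count L w (m - {#b#}))"
proof -
  define x y where "x = inv w a" and "y = inv w (Suc a)"
  have xy: "w x = a" "w y = Suc a" by (simp_all add: x_def y_def permutes_inverses[OF w])
  have in_n: "x \<in> {1..n}" "y \<in> {1..n}"
    using a permutes_in_image[OF permutes_inv[OF w]] by (simp_all add: x_def y_def)
  have inj: "inj w" using w by (rule permutes_inj)
  have kx: "k = x \<longleftrightarrow> w k = a" "k = y \<longleftrightarrow> w k = Suc a"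
    using xy inj_eq[OF inj] by metis+
  let ?s = "simple_transp a \<circ> w" and ?m = "m - {#b#}"
  let ?D = "\<lambda>c. of_bool (k = x \<and> c = y) - of_bool (k = y \<and> c = x) :: int"
  have sc: "simple_transp a \<circ> swap_pos w k c = swap_pos ?s k c" for c
    by (simp add: swap_pos_def comp_assoc)
  \<comment> \<open>In a diagonal term the position swap undoes $s_a$, which leaves \<open>w\<close>
    itself.\<close>
  have sw: "swap_pos ?s x y = w" "swap_pos ?s y x = w"
    unfolding simple_transp_comp[OF inj xy] by (simp_all add: swap_pos_def comp_assoc transpose_commute)
  have "transition n k ((b, a) # L) w m = (\<Sum>c=1..n. cover_sign k w c * word_count L (swap_pos w k c) m
    + of_bool (b \<in># m) * ((cover_sign k w c * of_bool (left_descent a (swap_pos w k c)))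
      * word_count L (swap_pos ?s k c) ?m))"
    unfolding transition_def
  proof (rule sum.cong[OF refl])
    fix c assume "c \<in> {1..n}"
    then have "swap_pos w k c permutes {1..n}" using w k by (intro swap_pos_permutes)
    from word_count_Cons[OF this a(1) L, of m]
    show "cover_sign k w c * word_count ((b, a) # L) (swap_pos w k c) m =
      cover_sign k w c * word_count L (swap_pos w k c) m
      + of_bool (b \<in># m) * ((cover_sign k w c * of_bool (left_descent a (swap_pos w k c)))
      * word_count L (swap_pos ?s k c) ?m)"
      unfolding sc by (simp add: algebra_simps)
  qed
  also have "\<dots> = transition n k L w m + of_bool (b \<in># m) *
      (of_bool (left_descent a w) * transition n k L ?s ?m
       + (\<Sum>c=1..n. ?D c * word_count L (swap_pos ?s k c) ?m))"
    unfolding cover_sign_commutator[OF inj xy] transition_def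
    by (simp add: sum.distrib sum_distrib_left distrib_right mult.assoc)
  also have "(\<Sum>c=1..n. ?D c * word_count L (swap_pos ?s k c) ?m) =
    (\<Sum>c=1..n. of_bool (c = y) * (of_bool (k = x) * word_count L w ?m))
    - (\<Sum>c=1..n. of_bool (c = x) * (of_bool (k = y) * word_count L w ?m))"
    unfolding sum_subtractf[symmetric] using sw by (intro sum.cong refl) (auto simp: of_bool_def)
  also have "\<dots> = (of_bool (k = x) - of_bool (k = y)) * word_count L w ?m"
    using in_n by (simp add: of_bool_def if_distrib[of "\<lambda>x. x * _"] sum.delta algebra_simps cong: if_cong)
  finally show ?thesis unfolding kx .
qed

context
  fixes n i k j :: nat
  assumes ikj: "1 \<le> i" "i < k" "k < j" "j \<le> n"
begin

text \<open>
  A descending run of letters with one variable commutes with $T_k$ up to boundary terms at the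
  values \<open>1\<close> and \<open>Suc a\<close> of \<open>w k\<close>; the first cannot occur since \<open>w i < w k\<close>.
\<close>

lemma transition_letters:
  assumes L: "\<And>a. (b, a) \<notin> set L"
    and zero: "\<And>w m. w permutes {1..n} \<Longrightarrow> w i < w k \<Longrightarrow> w k < w j \<Longrightarrow> transition n k L w m = 0"
  shows "a < n \<Longrightarrow> w permutes {1..n} \<Longrightarrow> w i < w k \<Longrightarrow> w k < w j \<Longrightarrow>
    transition n k (letters b a @ L) w m =
      - of_bool (w k = Suc a \<and> b \<in># m) * word_count (letters b a @ L) w (m - {#b#})"
proof (induction a arbitrary: w m)
  case 0
  \<comment> \<open>The boundary term would need \<open>w k = 1\<close>, but \<open>w i\<close> is a
    smaller positive value.\<close>
  have "1 \<le> w i" using permutes_in_image[OF 0(2), of i] ikj by simp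
  then show ?case using 0 zero by simp
next
  case (Suc a)
  note w = Suc.prems(2)
  let ?A = "Suc a" and ?M = "letters b a @ L" and ?m = "m - {#b#}"
  let ?s = "simple_transp ?A \<circ> w"
  have k: "k \<in> {1..n}" and notin: "(b, ?A) \<notin> set ?M"
    using ikj L by (auto simp: set_letters)
  \<comment> \<open>Removing a left descent reverses only the inversion at \<open>y < x\<close>, so
    \<open>w i < w k\<close> and \<open>w k < w j\<close> survive and the induction hypothesis
    applies to \<open>?s\<close>. Its boundary value \<open>?A\<close> becomes \<open>Suc ?A\<close>
    for \<open>w\<close>.\<close>
  have desc: "transition n k ?M ?s ?m =
      - of_bool (w k = Suc ?A \<and> b \<in># ?m) * word_count ?M ?s (?m - {#b#})"
    if d: "left_descent ?A w"
  proof -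
    define x y where "x = inv w ?A" and "y = inv w (Suc ?A)"
    have xy: "w x = ?A" "w y = Suc ?A" by (simp_all add: x_def y_def permutes_inverses[OF w])
    have "y < x" using d by (simp add: left_descent_def x_def y_def)
    have inj: "inj w" using w by (rule permutes_inj)
    have "?s permutes {1..n}" using w d by (intro left_descent_permutes) auto
    moreover have "?s i < ?s k" "?s k < ?s j"
      using simple_transp_less_iff[OF inj xy] Suc.prems(3,4) ikj \<open>y < x\<close> by auto
    moreover have "?s k = ?A \<longleftrightarrow> w k = Suc ?A"
      by (auto simp: simple_transp_def transpose_def)
    ultimately show ?thesis using Suc.IH[of ?s ?m] Suc.prems(1) by (simp only: Suc_lessD)
  qed
  have IH: "transition n k ?M w m = - of_bool (w k = ?A \<and> b \<in># m) * word_count ?M w ?m"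
    using Suc by simp
  have "transition n k (letters b ?A @ L) w m = - of_bool (w k = ?A \<and> b \<in># m) * word_count ?M w ?m +
    of_bool (b \<in># m) * (of_bool (left_descent ?A w) *
        (- of_bool (w k = Suc ?A \<and> b \<in># ?m) * word_count ?M ?s (?m - {#b#}))
       + (of_bool (w k = ?A) - of_bool (w k = Suc ?A)) * word_count ?M w ?m)"
    using transition_Cons[OF w k _ _ notin, of m] Suc.prems(1) IH desc by simp
  \<comment> \<open>The sum telescopes: the terms with \<open>w k = ?A\<close> cancel, and those
    with \<open>w k = Suc ?A\<close> recombine through the recursion for
    \<open>word_count\<close>.\<close>
  also have "\<dots> = - of_bool (w k = Suc ?A \<and> b \<in># m) * word_count ((b, ?A) # ?M) w ?m"
    unfolding word_count_Cons[OF w _ notin, simplified] by (simp add: of_bool_def)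
  finally show ?case by simp
qed

text \<open>A full run of letters leaves only the boundary term at \<open>w k = n\<close>, which
  \<open>w k < w j\<close> excludes; so each variable can be peeled off in turn.\<close>

lemma transition_alphabet:
  "w permutes {1..n} \<Longrightarrow> w i < w k \<Longrightarrow> w k < w j \<Longrightarrow> transition n k (alphabet n r b) w m = 0"
proof (induction r arbitrary: b w m)
  case 0
  then show ?case using transition_Nil ikj by simp
next
  case (Suc r)
  have "w j \<le> n" using permutes_in_image[OF Suc.prems(1), of j] ikj by simp
  then have "w k \<noteq> Suc (n - 1)" using Suc.prems by simp
  moreover have "n - 1 < n" using ikj by simp
  ultimately show ?case
    using Suc transition_letters[of b "alphabet n r (Suc b)" "n - 1" w m] by (simp add: set_alphabet)
qed

text \<open>This is the vanishing of $F$ on $T_k u$, with the positive and negative terms moved to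
  opposite sides.\<close>

lemma transition_stanley:
  assumes u: "u permutes {1..n}" "u i < u k" "u k < u j"
  shows "(\<Sum>c\<in>{c. c \<le> n \<and> covers u k c}. stanley (swap_pos u k c)) =
    (\<Sum>c\<in>I_set u k. stanley (swap_pos u c k))"
proof
  fix m :: "nat multiset"
  \<comment> \<open>All variables of \<open>m\<close> are among the first \<open>r\<close>;
    inserting \<open>0\<close> handles the empty monomial.\<close>
  define r where "r = Max (insert 0 (set_mset m))"
  have r: "\<forall>b\<in>#m. b \<le> r" by (simp add: r_def)
  have I: "I_set u k = {c. 1 \<le> c \<and> covers u c k}"
    using inv_count_swap_pos_iff_covers[OF u(1)] ikj by (auto simp: I_set_def covers_def)
  have k: "k \<in> {1..n}" using ikj by simp
  have "0 = transition n k (alphabet n r 1) u m" using transition_alphabet[OF u] by simp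
  also have "\<dots> = (\<Sum>c=1..n. cover_sign k u c * stanley (swap_pos u k c) m)"
    unfolding transition_def
    using k u(1) by (intro sum.cong refl) (simp add: stanley_eq_word_count[OF swap_pos_permutes r])
  also have "\<dots> = (\<Sum>c=1..n. (if covers u k c then stanley (swap_pos u k c) m else 0)
      - (if covers u c k then stanley (swap_pos u c k) m else 0))"
    by (intro sum.cong refl)
      (auto simp: cover_sign_def covers_def swap_pos_def transpose_commute)
  also have "\<dots> = (\<Sum>c\<in>{1..n} \<inter> {c. covers u k c}. stanley (swap_pos u k c) m)
      - (\<Sum>c\<in>{1..n} \<inter> {c. covers u c k}. stanley (swap_pos u c k) m)"
    by (simp add: sum_subtractf sum.inter_restrict)
  also have "{1..n} \<inter> {c. covers u k c} = {c. c \<le> n \<and> covers u k c}"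
    using k by (auto simp: covers_def)
  also have "{1..n} \<inter> {c. covers u c k} = I_set u k"
    using k by (auto simp: covers_def I)
  finally show "(\<Sum>c\<in>{c. c \<le> n \<and> covers u k c}. stanley (swap_pos u k c)) m =
    (\<Sum>c\<in>I_set u k. stanley (swap_pos u c k)) m"
    by (simp add: sum_apply)
qed

end

section \<open>Specialising the transition formula to the extremal 132 pattern\<close>

theorem theorem4p3:
  fixes n p q :: nat and w :: "nat \<Rightarrow> nat"
  assumes "w permutes {1..n}"
    and "contains_132 n w"
    and "p = Max {t. \<exists>i j. 1 \<le> i \<and> i < t \<and> t < j \<and> j \<le> n \<and> w i < w j \<and> w j < w t}"
    and "q = Max {j. p < j \<and> j \<le> n \<and> w j < w p \<and> (\<exists>i. 1 \<le> i \<and> i < p \<and> w i < w j)}"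
  shows "stanley w = (\<Sum>w'\<in>Phi (swap_pos w p q) p. stanley w')
    \<and> I_set (swap_pos w p q) p \<noteq> {}
    \<and> (\<forall>w'\<in>Phi (swap_pos w p q) p. w' permutes {1..n})"
proof -
  note w = assms(1)
  define P where "P = {t. \<exists>i j. 1 \<le> i \<and> i < t \<and> t < j \<and> j \<le> n \<and> w i < w j \<and> w j < w t}"
  define Q where "Q = {j. p < j \<and> j \<le> n \<and> w j < w p \<and> (\<exists>i. 1 \<le> i \<and> i < p \<and> w i < w j)}"
  have finP: "finite P" by (rule finite_subset[of _ "{..n}"]) (auto simp: P_def)
  have finQ: "finite Q" by (rule finite_subset[of _ "{..n}"]) (auto simp: Q_def)
  have "P \<noteq> {}" using assms(2) unfolding contains_132_def P_def by blast
  then have "p \<in> P" unfolding assms(3) P_def[symmetric] using finP by (rule Max_in[rotated])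
  then have "Q \<noteq> {}" unfolding P_def Q_def by blast
  then have "q \<in> Q" unfolding assms(4) Q_def[symmetric] using finQ by (rule Max_in[rotated])
  then obtain i where q: "p < q" "q \<le> n" "w q < w p" and i: "1 \<le> i" "i < p" "w i < w q"
    by (auto simp: Q_def)
  have maxP: "t \<le> p" if "t \<in> P" for t
    unfolding assms(3) P_def[symmetric] using finP that by (rule Max_ge)
  have maxQ: "t \<le> q" if "t \<in> Q" for t
    unfolding assms(4) Q_def[symmetric] using finQ that by (rule Max_ge)
  \<comment> \<open>Otherwise \<open>i\<close>, \<open>t\<close>, \<open>q\<close> would form a 132
    pattern whose middle position exceeds the maximal \<open>p\<close>.\<close>
  have small: "w t < w q" if t: "p < t" "t < q" for t
  proof (rule ccontr)
    assume "\<not> w t < w q"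
    moreover have "w t \<noteq> w q" using permutes_inj[OF w] t by (simp add: inj_eq)
    ultimately have "1 \<le> i \<and> i < t \<and> t < q \<and> q \<le> n \<and> w i < w q \<and> w q < w t"
      using t q i by auto
    then have "t \<in> P" unfolding P_def by blast
    then show False using maxP t by fastforce
  qed
  define u where "u = swap_pos w p q"
  have u: "u permutes {1..n}"
    unfolding u_def using w q i by (intro swap_pos_permutes) auto
  have up: "u p = w q" "u q = w p" by (simp_all add: u_def swap_pos_def)
  have u_other: "u t = w t" if "t \<noteq> p" "t \<noteq> q" for t using that by (simp add: u_def swap_pos_def)
  have ui: "u i < u p" using u_other[of i] i q up by simp
  have uq: "u p < u q" using up q by simp
  \<comment> \<open>A cover at \<open>c < q\<close> contradicts \<open>small\<close>. For
    \<open>c > q\<close>, either \<open>w c > w p\<close> and position \<open>q\<close> obstructs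
    the cover, or \<open>w c < w p\<close> and \<open>c\<close> lies in \<open>Q\<close> beyond its
    maximum.\<close>
  have right: "{c. c \<le> n \<and> covers u p c} = {q}"
  proof (intro equalityI subsetI)
    fix c assume "c \<in> {c. c \<le> n \<and> covers u p c}"
    then have c: "c \<le> n" "p < c" "u p < u c"
      and between: "\<And>t. p < t \<Longrightarrow> t < c \<Longrightarrow> \<not> (u p < u t \<and> u t < u c)"
      by (auto simp: covers_def)
    consider "c < q" | "c = q" | "q < c" by linarith
    then show "c \<in> {q}"
    proof cases
      case 1
      then show ?thesis using small[of c] c up u_other[of c] by simp
    next
      case 3
      then have wc: "u c = w c" using u_other[of c] c by simp
      have "w p \<noteq> w c" using permutes_inj[OF w] c by (simp add: inj_eq)
      then have "w c < w p" using between[of q] 3 q uq up wc by auto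
      then have "c \<in> Q" unfolding Q_def using c i up wc by (auto intro!: exI[of _ i])
      then show ?thesis using maxQ 3 by fastforce
    qed simp
  next
    fix c assume "c \<in> {q}"
    moreover have "\<not> (u p < u t \<and> u t < u q)" if "p < t" "t < q" for t
      using small[OF that] u_other[of t] that up by simp
    ultimately show "c \<in> {c. c \<le> n \<and> covers u p c}" using q uq by (simp add: covers_def)
  qed
  \<comment> \<open>The nearest smaller entry to the left of \<open>p\<close> always gives a cover,
    so \<open>Phi\<close> stops without recursion.\<close>
  define i' where "i' = Max {t. 1 \<le> t \<and> t < p \<and> u t < u p}"
  have fin: "finite {t. 1 \<le> t \<and> t < p \<and> u t < u p}" by simp
  then have "i' \<in> {t. 1 \<le> t \<and> t < p \<and> u t < u p}"
    unfolding i'_def using ui i by (intro Max_in) auto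
  then have i': "1 \<le> i'" "i' < p" "u i' < u p" by simp_all
  have "\<not> u t < u p" if "i' < t" "t < p" for t
    using Max_ge[OF fin, of t] that i' unfolding i'_def[symmetric] by auto
  then have "covers u i' p" using i' by (auto simp: covers_def)
  then have ne: "I_set u p \<noteq> {}"
    using inv_count_swap_pos_iff_covers[OF u, of i' p] i' q by (auto simp: I_set_def)
  have Phi: "Phi u p = (\<lambda>c. swap_pos u c p) ` I_set u p"
    using ne by (subst Phi.simps) auto
  have "inj_on (\<lambda>c. swap_pos u c p) (I_set u p)"
  proof (rule inj_onI)
    fix c d assume "c \<in> I_set u p" "d \<in> I_set u p" and eq: "swap_pos u c p = swap_pos u d p"
    have "u c = u d" using fun_cong[OF eq, of p] by (simp add: swap_pos_def)
    then show "c = d" using permutes_inj[OF u] by (simp add: inj_eq)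
  qed
  then have "(\<Sum>w'\<in>Phi u p. stanley w') = (\<Sum>c\<in>I_set u p. stanley (swap_pos u c p))"
    unfolding Phi by (simp add: sum.reindex)
  \<comment> \<open>The values of \<open>u\<close> at \<open>i\<close>, \<open>p\<close>,
    \<open>q\<close> increase, as the transition formula requires, and \<open>q\<close> is the only
    cover to the right.\<close>
  also have "\<dots> = (\<Sum>c\<in>{q}. stanley (swap_pos u p c))"
    using transition_stanley[OF i(1,2) q(1,2) u ui uq] unfolding right by simp
  also have "\<dots> = stanley w" by (simp add: u_def swap_pos_twice)
  finally have "stanley w = (\<Sum>w'\<in>Phi u p. stanley w')" by simp
  moreover have "w' permutes {1..n}" if "w' \<in> Phi u p" for w'
    using that u i q unfolding Phi by (auto simp: I_set_def intro!: swap_pos_permutes)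
  ultimately show ?thesis using ne unfolding u_def by blast
qed

end
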